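(* Let $(\mathbf{B},\|\cdot\|)$ be a real separable Banach space and let $\{R_n;\,n\ge1\}$ be a Rademacher sequence. Let $\varphi(\cdot)$ and $\psi(\cdot)$ be two continuous and increasing functions defined on $[0,\infty)$ such that $\varphi(0)=\psi(0)=0$, $\lim_{t\to\infty}\varphi(t)=\infty$, and $\psi(\cdot)/\varphi(\cdot)$ is a nondecreasing function on $[0,\infty)$, where $\frac{\psi(0)}{\varphi(0)}$ is defined to be $\lim_{t\to0^+}\frac{\psi(t)}{\varphi(t)}$. For $n\ge1$, set $a_n=\varphi(n)$ and $b_n=\psi(n)$. Then: (i) Let $\{x_n;\,n\ge1\}$ be a $\mathbf{B}$-valued sequence such that $\|x_n\|\le b_n$, $n\ge1$. Then, for every $n\ge1$ and all $t\ge0$, $$\mathbb{P}\left(\left\|\sum_{i=1}^nR_ix_i\right\|>tb_n\right)\le 2\,\mathbb{P}\left(\left\|\sum_{i=1}^nR_i\,\varphi\left(\psi^{-1}(\|x_i\|)\right)\frac{x_i}{\|x_i\|}\right\|>ta_n\right).$$ (ii) If $\{V_n;\,n\ge1\}$ is a sequence of independent and symmetric $\mathbf{B}$-valued random variables, then, for every $n\ge1$ and all $t\ge0$, $$\mathbb{P}\left(\left\|\sum_{i=1}^nV_i\right\|>tb_n\right)\le 4\,\mathbb{P}\left(\left\|\sum_{i=1}^n\varphi\left(\psi^{-1}(\|V_i\|)\right)\frac{V_i}{\|V_i\|}\right\|>ta_n\right)+\sum_{i=1}^n\mathbb{P}\left(\|V_i\|>b_n\right).$$ Here the expression $\varphi\left(\psi^{-1}(\|x\|)\right)\frac{x}{\|x\|}$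 is interpreted as $0$ when $x=0$.
   Context: A Rademacher sequence is a sequence of i.i.d. real random variables $R_n$ with $\mathbb{P}(R_n=1)=\mathbb{P}(R_n=-1)=1/2$. A $\mathbf{B}$-valued random variable is a Borel measurable map from a probability space into $\mathbf{B}$; $V$ is symmetric if $V$ and $-V$ have the same distribution. "Increasing" means strictly increasing; $\psi^{-1}$ is the inverse function of $\psi$ on $[0,\infty)$. *)

theory Defs
  imports "HOL-Probability.Probability"
begin

definition rademacher_sequence :: "'a measure \<Rightarrow> (nat \<Rightarrow> 'a \<Rightarrow> real) \<Rightarrow> bool" where
  "rademacher_sequence M R \<longleftrightarrow>
     prob_space M \<and>
     prob_space.indep_vars M (\<lambda>_. borel) R {1..} \<and>
     (\<forall>n\<ge>1. \<P>(\<omega> in M. R n \<omega> = 1) = 1 / 2 \<and> \<P>(\<omega> in M. R n \<omega> = - 1) = 1 / 2)"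

definition symmetric_rv :: "'a measure \<Rightarrow> ('a \<Rightarrow> 'b::real_normed_vector) \<Rightarrow> bool" where
  "symmetric_rv M V \<longleftrightarrow>
     V \<in> borel_measurable M \<and> distr M borel V = distr M borel (\<lambda>\<omega>. - V \<omega>)"

text \<open>
  If \<open>\<psi>\<close> and \<open>\<phi>\<close> are positive on the open half-line and their quotient is nondecreasing
  there, the right limit at 0 exists, so \<open>Lim\<close> is then well-defined.
\<close>

definition ratio :: "(real \<Rightarrow> real) \<Rightarrow> (real \<Rightarrow> real) \<Rightarrow> real \<Rightarrow> real" where
  "ratio \<psi> \<phi> t = (if t = 0 then Lim (at_right 0) (\<lambda>s. \<psi> s / \<phi> s) else \<psi> t / \<phi> t)"

text \<open>
  \<open>inv_into {0..} \<psi>\<close> is the inverse of \<open>\<psi>\<close> on the closed half-line when \<open>\<psi>\<close> is a bijection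
  of \<open>{0..}\<close> onto itself. This holds if \<open>\<phi>\<close> and \<open>\<psi>\<close> are continuous, strictly increasing and
  vanish at 0, \<open>\<phi>\<close> is unbounded and \<open>ratio \<psi> \<phi>\<close> is nondecreasing on \<open>{0..}\<close>.
\<close>

definition rescale ::
  "(real \<Rightarrow> real) \<Rightarrow> (real \<Rightarrow> real) \<Rightarrow> 'b::real_normed_vector \<Rightarrow> 'b" where
  "rescale \<phi> \<psi> x =
     (if x = 0 then 0 else \<phi> (inv_into {0..} \<psi> (norm x)) *\<^sub>R (x /\<^sub>R norm x))"

end

theory Submission
  imports Defs
begin

text \<open>
  Write \<open>y\<^sub>i\<close> for the rescaled vectors. Since \<open>\<psi> / \<phi>\<close> is nondecreasing, \<open>(a\<^sub>n / b\<^sub>n) x\<^sub>i = \<alpha>\<^sub>i y\<^sub>i\<close> with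
  \<open>\<alpha>\<^sub>i\<close> in \<open>[0, 1]\<close>, so (i) is an instance of the contraction principle for signs. The latter follows by
  a reflection argument: if \<open>\<Sum> \<alpha>\<^sub>i \<epsilon>\<^sub>i y\<^sub>i\<close> is large, so is the sum of the \<open>\<epsilon>\<^sub>i y\<^sub>i\<close> over some superlevel set of \<open>\<alpha>\<close>, and
  reversing all signs outside that set maps the pattern to one whose sum over all indices, averaged
  with the original, equals this partial sum. For (ii), symmetry of the \<open>V\<^sub>i\<close> allows averaging over
  all sign patterns, and the contraction principle applies pointwise with \<open>\<alpha>\<^sub>i = 0\<close> where \<open>\<parallel>V\<^sub>i\<parallel> > b\<^sub>n\<close>;
  this gives (ii) even with the constant 2.
\<close>

section \<open>Contraction principle for finite families of signs\<close>

text \<open>Layer-cake decomposition: \<Sum> \<alpha> y is a nonnegative combination of sums over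
  superlevel sets of \<alpha>, with total weight the largest coefficient. The induction peels off
  the lowest layer, so the number of positive coefficients drops.\<close>

lemma norm_sum_scaled_le_of_level_sets:
  fixes y :: "'i \<Rightarrow> 'b::real_normed_vector" and \<alpha> :: "'i \<Rightarrow> real"
  assumes "finite I" and "\<And>i. i \<in> I \<Longrightarrow> 0 \<le> \<alpha> i \<and> \<alpha> i \<le> m" and "0 \<le> m"
    and "\<And>c. 0 < c \<Longrightarrow> norm (\<Sum>i | i \<in> I \<and> c \<le> \<alpha> i. y i) \<le> s"
  shows "norm (\<Sum>i\<in>I. \<alpha> i *\<^sub>R y i) \<le> m * s"
  using assms(2-)
proof (induction "card {i\<in>I. 0 < \<alpha> i}" arbitrary: \<alpha> m rule: less_induct)
  case less
  define J where "J = {i\<in>I. 0 < \<alpha> i}"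
  have s0: "0 \<le> s" using less.prems(3)[of 1] norm_ge_zero order_trans zero_less_one by metis
  have fJ: "finite J" using assms(1) by (simp add: J_def)
  have restr: "(\<Sum>i\<in>I. \<alpha> i *\<^sub>R y i) = (\<Sum>i\<in>J. \<alpha> i *\<^sub>R y i)"
    using assms(1) less.prems(1) by (intro sum.mono_neutral_right) (force simp: J_def)+
  show ?case
  proof (cases "J = {}")
    case True
    then show ?thesis using restr s0 less.prems(2) by simp
  next
    case False
    \<comment> \<open>The thickness of the lowest layer. Subtracting \<open>c\<close> on
      \<open>J\<close> annihilates the coefficient of a minimising index \<open>k\<close> and lowers
      the upper bound to \<open>m - c\<close>.\<close>
    define c where "c = Min (\<alpha> ` J)"
    have "c \<in> \<alpha> ` J" unfolding c_def using fJ False by (intro Min_in) auto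
    then obtain k where k: "k \<in> J" "\<alpha> k = c" by auto
    have c0: "0 < c" using k by (auto simp: J_def)
    have cm: "c \<le> m" using k less.prems(1) by (auto simp: J_def)
    have cle: "c \<le> \<alpha> i" if "i \<in> J" for i unfolding c_def using fJ that by simp
    define \<beta> where "\<beta> i = (if i \<in> J then \<alpha> i - c else 0)" for i
    have "{i\<in>I. 0 < \<beta> i} \<subset> J" using k by (auto simp: \<beta>_def J_def)
    then have lt: "card {i\<in>I. 0 < \<beta> i} < card {i\<in>I. 0 < \<alpha> i}"
      unfolding J_def[symmetric] using fJ by (rule psubset_card_mono[rotated])
    have \<beta>m: "0 \<le> \<beta> i \<and> \<beta> i \<le> m - c" if "i \<in> I" for i
      using less.prems(1)[OF that] cle cm by (auto simp: \<beta>_def)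
    have lev: "norm (\<Sum>i | i \<in> I \<and> d \<le> \<beta> i. y i) \<le> s" if "0 < d" for d
    proof -
      \<comment> \<open>Positive levels of \<beta> are levels of \<alpha> shifted by
        \<open>c\<close>, so the hypothesis on level sets is inherited.\<close>
      have "{i. i \<in> I \<and> d \<le> \<beta> i} = {i. i \<in> I \<and> c + d \<le> \<alpha> i}"
        using that c0 by (auto simp: \<beta>_def J_def split: if_splits)
      then show ?thesis using less.prems(3)[of "c + d"] that c0 by simp
    qed
    have IH: "norm (\<Sum>i\<in>I. \<beta> i *\<^sub>R y i) \<le> (m - c) * s"
      using less.hyps[OF lt \<beta>m _ lev] cm by simp
    have "J = {i. i \<in> I \<and> c \<le> \<alpha> i}" using cle c0 by (auto simp: J_def)
    then have top: "norm (\<Sum>i\<in>J. y i) \<le> s" using less.prems(3)[OF c0] by simp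
    have "(\<Sum>i\<in>I. \<beta> i *\<^sub>R y i) = (\<Sum>i\<in>J. \<beta> i *\<^sub>R y i)"
      using assms(1) by (intro sum.mono_neutral_right) (auto simp: J_def \<beta>_def)
    also have "\<dots> = (\<Sum>i\<in>J. \<alpha> i *\<^sub>R y i) - c *\<^sub>R (\<Sum>i\<in>J. y i)"
      by (simp add: \<beta>_def scaleR_left_diff_distrib sum_subtractf scaleR_sum_right)
    finally have "(\<Sum>i\<in>I. \<alpha> i *\<^sub>R y i) = (\<Sum>i\<in>I. \<beta> i *\<^sub>R y i) + c *\<^sub>R (\<Sum>i\<in>J. y i)"
      using restr by simp
    also have "norm \<dots> \<le> (m - c) * s + c * s"
      using IH top c0 by (intro norm_triangle_le add_mono) auto
    finally show ?thesis by (simp add: algebra_simps)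
  qed
qed

text \<open>A sign pattern is encoded by the set \<open>A\<close> of indices carrying the sign -1,
  so counting patterns becomes counting subsets of \<open>I\<close>.\<close>

definition flip_on :: "'i set \<Rightarrow> ('i \<Rightarrow> 'b::uminus) \<Rightarrow> 'i \<Rightarrow> 'b" where
  "flip_on A x i = (if i \<in> A then - x i else x i)"

text \<open>Counting form of the contraction principle. The factor 2 arises because each pattern
  counted on the left is good itself or is the reflection of a good one.\<close>

lemma card_sign_contraction:
  fixes y :: "'i \<Rightarrow> 'b::real_normed_vector" and \<alpha> :: "'i \<Rightarrow> real"
  assumes fin: "finite I" and \<alpha>: "\<And>i. i \<in> I \<Longrightarrow> 0 \<le> \<alpha> i \<and> \<alpha> i \<le> 1" and s: "0 \<le> s"
  shows "card {A \<in> Pow I. s < norm (\<Sum>i\<in>I. \<alpha> i *\<^sub>R flip_on A y i)}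
    \<le> 2 * card {A \<in> Pow I. s < norm (\<Sum>i\<in>I. flip_on A y i)}"
proof -
  define S where "S c A = (\<Sum>i | i \<in> I \<and> c \<le> \<alpha> i. flip_on A y i)" for c A
  define L where "L A = {c \<in> \<alpha> ` I. s < norm (S c A)}" for A
  \<comment> \<open>the partial sums over the level sets of \<open>\<alpha>\<close> play the role of a walk in Levy's maximal
    inequality; a pattern is reflected after the first exit time \<open>Max (L A)\<close>\<close>
  define r where "r A = sym_diff A {i\<in>I. \<alpha> i < Max (L A)}" for A
  define Good where "Good = {A \<in> Pow I. s < norm (\<Sum>i\<in>I. flip_on A y i)}"
  have finG: "finite Good" using fin by (simp add: Good_def)
  have finL: "finite (L A)" for A using fin by (simp add: L_def)
  have "A \<in> Good \<union> r ` Good" if A: "A \<in> Pow I" "s < norm (\<Sum>i\<in>I. \<alpha> i *\<^sub>R flip_on A y i)" for A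
  proof -
    have "\<exists>c>0. s < norm (S c A)"
    proof (rule ccontr)
      assume "\<not> ?thesis"
      then have "norm (\<Sum>i\<in>I. \<alpha> i *\<^sub>R flip_on A y i) \<le> 1 * s"
        using norm_sum_scaled_le_of_level_sets[OF fin \<alpha>, where y="flip_on A y" and s=s]
        by (force simp: S_def not_less)
      then show False using A(2) by simp
    qed
    then obtain c where c: "c > 0" "s < norm (S c A)" by blast
    \<comment> \<open>The level \<open>c\<close> need not be a value of \<alpha>. The least value of
      \<alpha> on \<open>K\<close> cuts out the same set and is attained, so it lies in
      \<open>L A\<close>.\<close>
    define K where "K = {i. i \<in> I \<and> c \<le> \<alpha> i}"
    have "K \<noteq> {}" using c(2) s unfolding S_def K_def[symmetric] by auto
    moreover have "finite K" using fin by (simp add: K_def)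
    ultimately have "Min (\<alpha> ` K) \<in> \<alpha> ` K" by (intro Min_in) auto
    moreover have "Min (\<alpha> ` K) \<le> \<alpha> i" if "i \<in> K" for i
      using \<open>finite K\<close> that by simp
    then have "K = {i. i \<in> I \<and> Min (\<alpha> ` K) \<le> \<alpha> i}"
      using \<open>Min (\<alpha> ` K) \<in> \<alpha> ` K\<close> by (auto simp: K_def)
    then have "S (Min (\<alpha> ` K)) A = S c A" unfolding S_def K_def[symmetric] by simp
    ultimately have "Min (\<alpha> ` K) \<in> L A" using c(2) by (auto simp: L_def K_def)
    then have ne: "L A \<noteq> {}" by auto
    define d where "d = Max (L A)"
    have dL: "d \<in> L A" unfolding d_def using finL ne by (rule Max_in)
    have dmax: "c \<le> d" if "c \<in> L A" for c unfolding d_def using finL that by (rule Max_ge)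
    \<comment> \<open>Reflection changes signs only strictly below level \<open>d\<close>. Hence the
      exit level of \<open>r A\<close> is again \<open>d\<close>, and reflecting twice restores
      \<open>A\<close>.\<close>
    have same: "S c (r A) = S c A" if "d \<le> c" for c
      unfolding S_def using that
      by (intro sum.cong refl) (auto simp: r_def flip_on_def d_def[symmetric])
    have dr: "d \<in> L (r A)" using dL same[of d] by (simp add: L_def)
    have "Max (L (r A)) = d"
    proof (rule Max_eqI[OF finL _ dr])
      fix c assume "c \<in> L (r A)"
      then show "c \<le> d"
        using same[of c] dmax[of c] by (cases "d \<le> c") (auto simp: L_def)
    qed
    then have rr: "r (r A) = A" unfolding r_def[of "r A"] by (auto simp: r_def d_def)
    \<comment> \<open>Terms below level \<open>d\<close> cancel and the others double; by the
      triangle inequality one of the two full sums exceeds \<open>s\<close>.\<close>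
    have "(\<Sum>i\<in>I. flip_on A y i) + (\<Sum>i\<in>I. flip_on (r A) y i)
      = (\<Sum>i\<in>I. if d \<le> \<alpha> i then 2 *\<^sub>R flip_on A y i else 0)"
      unfolding sum.distrib[symmetric]
      by (intro sum.cong refl) (auto simp: r_def flip_on_def d_def[symmetric] scaleR_2)
    also have "\<dots> = 2 *\<^sub>R S d A"
      unfolding S_def scaleR_sum_right by (rule sum.inter_filter[OF fin, symmetric])
    finally have "2 * norm (S d A)
      \<le> norm (\<Sum>i\<in>I. flip_on A y i) + norm (\<Sum>i\<in>I. flip_on (r A) y i)"
      by (metis norm_scaleR norm_triangle_ineq abs_numeral)
    moreover have "s < norm (S d A)" using dL by (simp add: L_def)
    moreover have "r A \<in> Pow I" using A(1) by (auto simp: r_def)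
    ultimately have "A \<in> Good \<or> r A \<in> Good" using A(1) by (auto simp: Good_def)
    then show ?thesis using rr by (metis UnI1 UnI2 imageI)
  qed
  then have "card {A \<in> Pow I. s < norm (\<Sum>i\<in>I. \<alpha> i *\<^sub>R flip_on A y i)} \<le> card (Good \<union> r ` Good)"
    using finG by (intro card_mono) auto
  also have "\<dots> \<le> card Good + card (r ` Good)" by (rule card_Un_le)
  also have "\<dots> \<le> 2 * card Good" using card_image_le[OF finG, of r] by simp
  finally show ?thesis by (simp add: Good_def)
qed

section \<open>Averaging over signs for independent symmetric variables\<close>

text \<open>By independence the joint law is the product of the marginals, and symmetry makes each
  marginal invariant under negation.\<close>

lemma (in prob_space) distr_flip_on:
  fixes V :: "'i \<Rightarrow> 'a \<Rightarrow> 'd::{real_normed_vector,second_countable_topology}"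
  assumes "I \<noteq> {}" and indep: "indep_vars (\<lambda>_. borel) V I"
    and sym: "\<And>i. i \<in> I \<Longrightarrow> symmetric_rv M (V i)"
  shows "distr M (\<Pi>\<^sub>M i\<in>I. borel) (\<lambda>\<omega>. \<lambda>i\<in>I. flip_on A (\<lambda>i. V i \<omega>) i)
    = distr M (\<Pi>\<^sub>M i\<in>I. borel) (\<lambda>\<omega>. \<lambda>i\<in>I. V i \<omega>)"
proof -
  have rv: "random_variable borel (V i)" if "i \<in> I" for i
    using sym[OF that] by (simp add: symmetric_rv_def)
  define W where "W i \<omega> = flip_on A (\<lambda>i. V i \<omega>) i" for i \<omega>
  have rvW: "random_variable borel (W i)" if "i \<in> I" for i
    unfolding W_def flip_on_def using rv[OF that] by simp
  have "indep_vars (\<lambda>_. borel) (\<lambda>i \<omega>. (\<lambda>v. if i \<in> A then - v else v) (V i \<omega>)) I"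
    by (rule indep_vars_compose2[OF indep]) simp
  then have indW: "indep_vars (\<lambda>_. borel) W I" by (simp add: W_def[abs_def] flip_on_def)
  have "distr M (\<Pi>\<^sub>M i\<in>I. borel) (\<lambda>\<omega>. \<lambda>i\<in>I. W i \<omega>) = (\<Pi>\<^sub>M i\<in>I. distr M borel (W i))"
    using indep_vars_iff_distr_eq_PiM'[of I W "\<lambda>_. borel", OF \<open>I \<noteq> {}\<close> rvW] indW by simp
  also have "\<dots> = (\<Pi>\<^sub>M i\<in>I. distr M borel (V i))"
  proof (intro PiM_cong refl)
    fix i assume "i \<in> I"
    from sym[OF this] show "distr M borel (W i) = distr M borel (V i)"
      by (cases "i \<in> A") (simp_all add: W_def[abs_def] flip_on_def symmetric_rv_def)
  qed
  also have "\<dots> = distr M (\<Pi>\<^sub>M i\<in>I. borel) (\<lambda>\<omega>. \<lambda>i\<in>I. V i \<omega>)"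
    using indep_vars_iff_distr_eq_PiM'[of I V "\<lambda>_. borel", OF \<open>I \<noteq> {}\<close> rv] indep by simp
  finally show ?thesis by (simp add: W_def)
qed

text \<open>Oddness moves a sign from \<open>H i (V i)\<close> onto \<open>V i\<close>, where the
  invariance of the joint law absorbs it.\<close>

lemma (in prob_space) prob_sum_odd_flip_on:
  fixes V :: "'i \<Rightarrow> 'a \<Rightarrow> 'd::{real_normed_vector,second_countable_topology}"
    and H :: "'i \<Rightarrow> 'd \<Rightarrow> 'b::{real_normed_vector,second_countable_topology}"
  assumes "I \<noteq> {}" and indep: "indep_vars (\<lambda>_. borel) V I"
    and sym: "\<And>i. i \<in> I \<Longrightarrow> symmetric_rv M (V i)"
    and H: "\<And>i. i \<in> I \<Longrightarrow> H i \<in> borel_measurable borel"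
    and odd: "\<And>i v. i \<in> I \<Longrightarrow> H i (- v) = - H i v"
  shows "\<P>(\<omega> in M. s < norm (\<Sum>i\<in>I. flip_on A (\<lambda>i. H i (V i \<omega>)) i))
    = \<P>(\<omega> in M. s < norm (\<Sum>i\<in>I. H i (V i \<omega>)))"
proof -
  let ?P = "\<Pi>\<^sub>M i\<in>I. (borel :: 'd measure)"
  \<comment> \<open>The event is written as a set in the product space, so that equality of the
    joint laws applies to it.\<close>
  define E where "E = {x \<in> space ?P. s < norm (\<Sum>i\<in>I. H i (x i))}"
  have Hc: "(\<lambda>x. H i (x i)) \<in> borel_measurable ?P" if "i \<in> I" for i
    using measurable_compose[OF measurable_component_singleton[OF that] H[OF that]] .
  have E: "E \<in> sets ?P"
    unfolding E_def using Hc by measurable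
  have rv: "V i \<in> borel_measurable M" if "i \<in> I" for i
    using sym[OF that] by (simp add: symmetric_rv_def)
  have rvW: "(\<lambda>\<omega>. flip_on A (\<lambda>i. V i \<omega>) i) \<in> borel_measurable M" if "i \<in> I" for i
    unfolding flip_on_def using rv[OF that] by simp
  have "\<P>(\<omega> in M. s < norm (\<Sum>i\<in>I. flip_on A (\<lambda>i. H i (V i \<omega>)) i))
    = measure (distr M ?P (\<lambda>\<omega>. \<lambda>i\<in>I. flip_on A (\<lambda>i. V i \<omega>) i)) E"
  proof (subst measure_distr[OF measurable_restrict[OF rvW] E], assumption,
      rule arg_cong[where f="measure M"])
    have "(\<Sum>i\<in>I. flip_on A (\<lambda>i. H i (V i \<omega>)) i)
      = (\<Sum>i\<in>I. H i ((\<lambda>i\<in>I. flip_on A (\<lambda>i. V i \<omega>) i) i))" for \<omega>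
      by (intro sum.cong refl) (simp add: flip_on_def odd)
    then show "{\<omega> \<in> space M. s < norm (\<Sum>i\<in>I. flip_on A (\<lambda>i. H i (V i \<omega>)) i)}
      = (\<lambda>\<omega>. \<lambda>i\<in>I. flip_on A (\<lambda>i. V i \<omega>) i) -` E \<inter> space M"
      by (auto simp: E_def space_PiM)
  qed
  also have "\<dots> = measure (distr M ?P (\<lambda>\<omega>. \<lambda>i\<in>I. V i \<omega>)) E"
    by (simp add: distr_flip_on[OF assms(1) indep sym])
  also have "\<dots> = \<P>(\<omega> in M. s < norm (\<Sum>i\<in>I. H i (V i \<omega>)))"
    by (subst measure_distr[OF measurable_restrict[OF rv] E], assumption,
      rule arg_cong[where f="measure M"]) (auto simp: E_def space_PiM)
  finally show ?thesis .
qed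

text \<open>All \<open>2 ^ card I\<close> sign patterns give the same probability, so that
  probability is a normalised expected number of patterns exceeding \<open>s\<close>; these numbers
  are compared pointwise. The contracting coefficient may depend on the value \<open>v\<close>,
  since signs are counted with the outcome fixed.\<close>

lemma (in prob_space) prob_contraction:
  fixes V :: "'i \<Rightarrow> 'a \<Rightarrow> 'd::{real_normed_vector,second_countable_topology}"
    and F G :: "'i \<Rightarrow> 'd \<Rightarrow> 'b::{real_normed_vector,second_countable_topology}"
  assumes I: "finite I" "I \<noteq> {}" and indep: "indep_vars (\<lambda>_. borel) V I"
    and sym: "\<And>i. i \<in> I \<Longrightarrow> symmetric_rv M (V i)"
    and F: "\<And>i. i \<in> I \<Longrightarrow> F i \<in> borel_measurable borel"
    and oddF: "\<And>i v. i \<in> I \<Longrightarrow> F i (- v) = - F i v"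
    and G: "\<And>i. i \<in> I \<Longrightarrow> G i \<in> borel_measurable borel"
    and oddG: "\<And>i v. i \<in> I \<Longrightarrow> G i (- v) = - G i v"
    and contr: "\<And>i v. i \<in> I \<Longrightarrow> \<exists>c. 0 \<le> c \<and> c \<le> 1 \<and> F i v = c *\<^sub>R G i v"
    and s: "0 \<le> s"
  shows "\<P>(\<omega> in M. s < norm (\<Sum>i\<in>I. F i (V i \<omega>)))
    \<le> 2 * \<P>(\<omega> in M. s < norm (\<Sum>i\<in>I. G i (V i \<omega>)))"
proof -
  have rv: "V i \<in> borel_measurable M" if "i \<in> I" for i
    using sym[OF that] by (simp add: symmetric_rv_def)
  define B where
    "B H A = {\<omega> \<in> space M. s < norm (\<Sum>i\<in>I. flip_on A (\<lambda>i. H i (V i \<omega>)) i)}"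
    for H :: "'i \<Rightarrow> 'd \<Rightarrow> 'b" and A
  have average: "B H A \<in> events"
      "2 ^ card I * \<P>(\<omega> in M. s < norm (\<Sum>i\<in>I. H i (V i \<omega>)))
        = expectation (\<lambda>\<omega>. real (card {A \<in> Pow I. \<omega> \<in> B H A}))"
      "integrable M (\<lambda>\<omega>. real (card {A \<in> Pow I. \<omega> \<in> B H A}))"
    if H: "\<And>i. i \<in> I \<Longrightarrow> H i \<in> borel_measurable borel"
      and odd: "\<And>i v. i \<in> I \<Longrightarrow> H i (- v) = - H i v" for H A
  proof -
    have Hc: "(\<lambda>\<omega>. flip_on A (\<lambda>i. H i (V i \<omega>)) i) \<in> borel_measurable M" if "i \<in> I" for i A
      using measurable_compose[OF rv[OF that] H[OF that]] by (simp add: flip_on_def)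
    have ev: "B H A \<in> events" for A
      unfolding B_def using Hc[of _ A] by measurable
    show "B H A \<in> events" by (rule ev)
    have eq: "real (card {A \<in> Pow I. \<omega> \<in> B H A}) = (\<Sum>A\<in>Pow I. indicator (B H A) \<omega>)" for \<omega>
      using I(1) by (simp add: indicator_def sum.If_cases Int_def)
    have int: "integrable M (indicator (B H A) :: 'a \<Rightarrow> real)" for A
      using ev by (simp add: integrable_indicator_iff emeasure_eq_measure)
    show "integrable M (\<lambda>\<omega>. real (card {A \<in> Pow I. \<omega> \<in> B H A}))"
      unfolding eq using int by simp
    have "expectation (\<lambda>\<omega>. real (card {A \<in> Pow I. \<omega> \<in> B H A})) = (\<Sum>A\<in>Pow I. prob (B H A))"
      unfolding eq using int ev by (simp add: Bochner_Integration.integral_sum)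
    also have "\<dots> = (\<Sum>A\<in>Pow I. \<P>(\<omega> in M. s < norm (\<Sum>i\<in>I. H i (V i \<omega>))))"
      unfolding B_def
      by (intro sum.cong refl prob_sum_odd_flip_on[OF I(2) indep sym H odd])
    finally show "2 ^ card I * \<P>(\<omega> in M. s < norm (\<Sum>i\<in>I. H i (V i \<omega>)))
        = expectation (\<lambda>\<omega>. real (card {A \<in> Pow I. \<omega> \<in> B H A}))"
      using I(1) by (simp add: card_Pow)
  qed
  have le: "real (card {A \<in> Pow I. \<omega> \<in> B F A}) \<le> 2 * real (card {A \<in> Pow I. \<omega> \<in> B G A})"
    if "\<omega> \<in> space M" for \<omega>
  proof -
    \<comment> \<open>With \<omega> fixed, the values \<open>G i (V i \<omega>)\<close> are
      deterministic vectors and the coefficients can be chosen index by index.\<close>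
    obtain c where c: "\<And>i. i \<in> I \<Longrightarrow> 0 \<le> c i \<and> c i \<le> 1 \<and> F i (V i \<omega>) = c i *\<^sub>R G i (V i \<omega>)"
      using bchoice[of I "\<lambda>i c. 0 \<le> c \<and> c \<le> 1 \<and> F i (V i \<omega>) = c *\<^sub>R G i (V i \<omega>)"] contr by auto
    have "(\<Sum>i\<in>I. flip_on A (\<lambda>i. F i (V i \<omega>)) i)
      = (\<Sum>i\<in>I. c i *\<^sub>R flip_on A (\<lambda>i. G i (V i \<omega>)) i)" for A
      using c by (intro sum.cong refl) (auto simp: flip_on_def)
    then show ?thesis
      using card_sign_contraction[OF I(1), of c s "\<lambda>i. G i (V i \<omega>)"] c s that
      by (simp add: B_def)
  qed
  have avF: "2 ^ card I * \<P>(\<omega> in M. s < norm (\<Sum>i\<in>I. F i (V i \<omega>)))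
        = expectation (\<lambda>\<omega>. real (card {A \<in> Pow I. \<omega> \<in> B F A}))"
      "integrable M (\<lambda>\<omega>. real (card {A \<in> Pow I. \<omega> \<in> B F A}))"
    by ((rule average(2); simp add: F oddF), (rule average(3); simp add: F oddF))
  have avG: "2 ^ card I * \<P>(\<omega> in M. s < norm (\<Sum>i\<in>I. G i (V i \<omega>)))
        = expectation (\<lambda>\<omega>. real (card {A \<in> Pow I. \<omega> \<in> B G A}))"
      "integrable M (\<lambda>\<omega>. real (card {A \<in> Pow I. \<omega> \<in> B G A}))"
    by ((rule average(2); simp add: G oddG), (rule average(3); simp add: G oddG))
  have "2 ^ card I * \<P>(\<omega> in M. s < norm (\<Sum>i\<in>I. F i (V i \<omega>)))
    \<le> expectation (\<lambda>\<omega>. 2 * real (card {A \<in> Pow I. \<omega> \<in> B G A}))"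
    unfolding avF(1) using avF(2) avG(2) le by (intro integral_mono) auto
  also have "\<dots> = 2 ^ card I * (2 * \<P>(\<omega> in M. s < norm (\<Sum>i\<in>I. G i (V i \<omega>))))"
    using avG(1) by simp
  finally show ?thesis by simp
qed

text \<open>The atoms at 1 and -1 carry all the mass, so their weights determine the law, and
  negation swaps two equal weights.\<close>

lemma (in prob_space) symmetric_rv_sign:
  fixes X :: "'a \<Rightarrow> real"
  assumes X[measurable]: "X \<in> borel_measurable M"
    and p: "\<P>(\<omega> in M. X \<omega> = 1) = 1 / 2" "\<P>(\<omega> in M. X \<omega> = - 1) = 1 / 2"
  shows "symmetric_rv M X"
proof -
  \<comment> \<open>Stated for a general \<open>Y\<close>, because it is applied to both
    \<open>X\<close> and \<open>- X\<close>.\<close>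
  have dist: "prob {\<omega> \<in> space M. Y \<omega> \<in> A} = indicator A 1 / 2 + indicator A (- 1) / 2"
    if [measurable]: "Y \<in> borel_measurable M" "A \<in> sets borel"
      and p: "\<P>(\<omega> in M. Y \<omega> = 1) = 1 / 2" "\<P>(\<omega> in M. Y \<omega> = - 1) = 1 / 2"
    for A and Y :: "'a \<Rightarrow> real"
  proof -
    have "prob ({\<omega> \<in> space M. Y \<omega> = 1} \<union> {\<omega> \<in> space M. Y \<omega> = - 1}) = 1"
      using p by (subst finite_measure_Union) auto
    then have "AE \<omega> in M. \<omega> \<in> {\<omega> \<in> space M. Y \<omega> = 1} \<union> {\<omega> \<in> space M. Y \<omega> = - 1}"
      by (rule AE_prob_1)
    then have "prob {\<omega> \<in> space M. Y \<omega> \<in> A}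
      = prob ({\<omega> \<in> space M. Y \<omega> = 1 \<and> 1 \<in> A} \<union> {\<omega> \<in> space M. Y \<omega> = - 1 \<and> - 1 \<in> A})"
      by (intro finite_measure_eq_AE) auto
    also have "\<dots> = prob {\<omega> \<in> space M. Y \<omega> = 1 \<and> 1 \<in> A} + prob {\<omega> \<in> space M. Y \<omega> = - 1 \<and> - 1 \<in> A}"
      by (rule finite_measure_Union) auto
    finally show ?thesis using p by (cases "1 \<in> A"; cases "- 1 \<in> A") auto
  qed
  have p': "\<P>(\<omega> in M. - X \<omega> = 1) = 1 / 2" "\<P>(\<omega> in M. - X \<omega> = - 1) = 1 / 2"
    proof -
    have "(- X \<omega> = 1) = (X \<omega> = - 1)" for \<omega> by linarith
    then show "\<P>(\<omega> in M. - X \<omega> = 1) = 1 / 2" "\<P>(\<omega> in M. - X \<omega> = - 1) = 1 / 2"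
      using p by simp_all
  qed
  have "distr M borel X = distr M borel (\<lambda>\<omega>. - X \<omega>)"
  proof (rule measure_eqI)
    fix A assume "A \<in> sets (distr M borel X)"
    then have A[measurable]: "A \<in> sets borel" by simp
    show "emeasure (distr M borel X) A = emeasure (distr M borel (\<lambda>\<omega>. - X \<omega>)) A"
      using dist[OF X A p] dist[OF _ A p']
      by (simp add: emeasure_distr emeasure_eq_measure vimage_def Int_def conj_commute)
  qed simp
  then show ?thesis by (simp add: symmetric_rv_def)
qed

section \<open>Scaling functions and the rescaling map\<close>

locale scale_pair =
  fixes \<phi> \<psi> :: "real \<Rightarrow> real"
  assumes mono_\<phi>: "strict_mono_on {0..} \<phi>" and \<phi>0: "\<phi> 0 = 0"
    and cont_\<psi>: "continuous_on {0..} \<psi>" and mono_\<psi>: "strict_mono_on {0..} \<psi>" and \<psi>0: "\<psi> 0 = 0"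
    and \<phi>_top: "filterlim \<phi> at_top at_top"
    and ratio_mono: "mono_on {0..} (ratio \<psi> \<phi>)"
begin

lemma \<phi>_pos: "0 < s \<Longrightarrow> 0 < \<phi> s"
  using strict_mono_onD[OF mono_\<phi>, of 0 s] \<phi>0 by simp

lemma \<psi>_pos: "0 < s \<Longrightarrow> 0 < \<psi> s"
  using strict_mono_onD[OF mono_\<psi>, of 0 s] \<psi>0 by simp

lemma quotient_mono: "0 < s \<Longrightarrow> s \<le> t \<Longrightarrow> \<psi> s / \<phi> s \<le> \<psi> t / \<phi> t"
  using mono_onD[OF ratio_mono, of s t] by (simp add: ratio_def)

text \<open>On [1, \<infinity>) the quotient \<psi> / \<phi> is at least its value \<open>k\<close>
  at 1, so \<psi> dominates \<open>k\<close> times \<phi> and is unbounded; the intermediate value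
  theorem does the rest. This makes \<open>\<psi>inv\<close> a genuine inverse at every
  norm.\<close>

lemma \<psi>_surj: assumes "0 \<le> u" shows "u \<in> \<psi> ` {0..}"
proof -
  define k where "k = \<psi> 1 / \<phi> 1"
  have k: "0 < k" unfolding k_def using \<phi>_pos \<psi>_pos by simp
  have "eventually (\<lambda>t. u / k \<le> \<phi> t) at_top" using \<phi>_top by (simp add: filterlim_at_top)
  then have "eventually (\<lambda>t. u / k \<le> \<phi> t \<and> 1 \<le> t) at_top"
    using eventually_ge_at_top by (rule eventually_conj)
  then obtain t where t: "u / k \<le> \<phi> t" "1 \<le> t" by (auto simp: eventually_at_top_linorder)
  have "k \<le> \<psi> t / \<phi> t" unfolding k_def using quotient_mono t(2) by simp
  then have "k * \<phi> t \<le> \<psi> t" using \<phi>_pos[of t] t(2) by (simp add: field_simps)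
  moreover have "u \<le> k * \<phi> t" using t(1) k by (simp add: field_simps)
  ultimately have "u \<le> \<psi> t" by simp
  moreover have "continuous_on {0..t} \<psi>" using cont_\<psi> by (rule continuous_on_subset) auto
  ultimately obtain x where "0 \<le> x" "x \<le> t" "\<psi> x = u"
    using IVT'[of \<psi> 0 u t] assms \<psi>0 t(2) by auto
  then show ?thesis by auto
qed

abbreviation "\<psi>inv \<equiv> inv_into {0..} \<psi>"

lemma \<psi>inv: "0 \<le> u \<Longrightarrow> 0 \<le> \<psi>inv u \<and> \<psi> (\<psi>inv u) = u"
  using inv_into_into[OF \<psi>_surj] f_inv_into_f[OF \<psi>_surj] by simp

lemma \<psi>_le_iff: "0 \<le> s \<Longrightarrow> 0 \<le> t \<Longrightarrow> \<psi> s \<le> \<psi> t \<longleftrightarrow> s \<le> t"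
  using strict_mono_on_leD[OF mono_\<psi>] strict_mono_onD[OF mono_\<psi>] by (metis atLeast_iff not_less)

lemma rescale_minus: "rescale \<phi> \<psi> (- x) = - rescale \<phi> \<psi> x"
  by (simp add: rescale_def)

lemma rescale_measurable:
  "rescale \<phi> \<psi> \<in> borel_measurable (borel :: 'b::{real_normed_vector,second_countable_topology} measure)"
proof -
  \<comment> \<open>Truncating at 0 avoids the arbitrary values of \<open>inv_into\<close> at
    negative arguments and makes \<open>k\<close> monotone on the whole line, hence Borel.\<close>
  define k where "k u = \<phi> (\<psi>inv (max 0 u))" for u
  have "mono k"
  proof (rule monoI)
    fix u v :: real assume "u \<le> v"
    then have "\<psi>inv (max 0 u) \<le> \<psi>inv (max 0 v)"
      using \<psi>_le_iff[of "\<psi>inv (max 0 u)" "\<psi>inv (max 0 v)"] \<psi>inv[of "max 0 u"] \<psi>inv[of "max 0 v"]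
      by (simp add: max.coboundedI2)
    then show "k u \<le> k v"
      unfolding k_def using \<psi>inv[of "max 0 u"] \<psi>inv[of "max 0 v"]
      by (intro strict_mono_on_leD[OF mono_\<phi>]) auto
  qed
  then have [measurable]: "k \<in> borel_measurable borel" by (rule borel_measurable_mono)
  have "rescale \<phi> \<psi> = (\<lambda>x :: 'b. k (norm x) *\<^sub>R (x /\<^sub>R norm x))"
    by (auto simp: rescale_def k_def)
  also have "\<dots> \<in> borel_measurable borel" by measurable
  finally show ?thesis .
qed

text \<open>With \<open>s = \<psi>inv (norm x)\<close>, rescaling multiplies a nonzero
  \<open>x\<close> by \<phi>(s) / \<psi>(s). As s \<le> t, monotonicity of \<psi> / \<phi> bounds
  the ratio of the two multipliers by 1.\<close>

lemma scaled_eq_contracted_rescale: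
  fixes x :: "'b::real_normed_vector"
  assumes "0 < t" and "norm x \<le> \<psi> t"
  shows "\<exists>c. 0 \<le> c \<and> c \<le> 1 \<and> (\<phi> t / \<psi> t) *\<^sub>R x = c *\<^sub>R rescale \<phi> \<psi> x"
proof (cases "x = 0")
  case True
  then show ?thesis by (intro exI[of _ 0]) simp
next
  case False
  define s where "s = \<psi>inv (norm x)"
  have s: "0 \<le> s" "\<psi> s = norm x" unfolding s_def using \<psi>inv[of "norm x"] by auto
  have s0: "0 < s" using s False \<psi>0 by (cases "s = 0") auto
  have st: "s \<le> t" using \<psi>_le_iff[of s t] s assms by simp
  define c where "c = (\<psi> s / \<phi> s) / (\<psi> t / \<phi> t)"
  note pos = \<phi>_pos[OF s0] \<psi>_pos[OF s0] \<phi>_pos[OF assms(1)] \<psi>_pos[OF assms(1)]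
  have "0 \<le> c" "c \<le> 1"
    unfolding c_def using quotient_mono[OF s0 st] pos by (simp_all add: divide_le_eq_1_pos del: divide_divide_eq_left divide_divide_eq_right)
  moreover have "(\<phi> t / \<psi> t) *\<^sub>R x = c *\<^sub>R rescale \<phi> \<psi> x"
    using False pos s(2) by (simp add: rescale_def s_def[symmetric] c_def field_simps)
  ultimately show ?thesis by blast
qed

end

section \<open>The two tail comparisons\<close>

theorem theorem2p1:
  fixes M :: "'a measure"
    and R :: "nat \<Rightarrow> 'a \<Rightarrow> real"
    and N :: "'c measure"
    and \<phi> \<psi> :: "real \<Rightarrow> real"
  assumes "rademacher_sequence M R"
    and "continuous_on {0..} \<phi>" and "strict_mono_on {0..} \<phi>" and "\<phi> 0 = 0"
    and "continuous_on {0..} \<psi>" and "strict_mono_on {0..} \<psi>" and "\<psi> 0 = 0"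
    and "filterlim \<phi> at_top at_top"
    and "mono_on {0..} (ratio \<psi> \<phi>)"
    and "prob_space N"
  shows
    "(\<forall>x :: nat \<Rightarrow> 'b::{banach,second_countable_topology}.
        (\<forall>n\<ge>1. norm (x n) \<le> \<psi> (real n)) \<longrightarrow>
        (\<forall>n\<ge>1. \<forall>t\<ge>0.
          \<P>(\<omega> in M. norm (\<Sum>i=1..n. R i \<omega> *\<^sub>R x i) > t * \<psi> (real n))
          \<le> 2 * \<P>(\<omega> in M. norm (\<Sum>i=1..n. R i \<omega> *\<^sub>R rescale \<phi> \<psi> (x i)) > t * \<phi> (real n))))
     \<and>
     (\<forall>V :: nat \<Rightarrow> 'c \<Rightarrow> 'b.
        prob_space.indep_vars N (\<lambda>_. borel) V {1..} \<and> (\<forall>n\<ge>1. symmetric_rv N (V n)) \<longrightarrow>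
        (\<forall>n\<ge>1. \<forall>t\<ge>0.
          \<P>(\<omega> in N. norm (\<Sum>i=1..n. V i \<omega>) > t * \<psi> (real n))
          \<le> 4 * \<P>(\<omega> in N. norm (\<Sum>i=1..n. rescale \<phi> \<psi> (V i \<omega>)) > t * \<phi> (real n))
            + (\<Sum>i=1..n. \<P>(\<omega> in N. norm (V i \<omega>) > \<psi> (real n)))))"
proof -
  interpret S: scale_pair \<phi> \<psi> by unfold_locales (fact assms)+
  show ?thesis
  proof (intro conjI allI impI)
    fix x :: "nat \<Rightarrow> 'b" and n :: nat and t :: real
    assume x: "\<forall>n\<ge>1. norm (x n) \<le> \<psi> (real n)" and n: "1 \<le> n" and t: "0 \<le> t"
    interpret prob_space M using assms(1) by (simp add: rademacher_sequence_def)
    have ind: "indep_vars (\<lambda>_. borel) R {1..}"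
      and p: "\<And>i. 1 \<le> i \<Longrightarrow> \<P>(\<omega> in M. R i \<omega> = 1) = 1 / 2 \<and> \<P>(\<omega> in M. R i \<omega> = - 1) = 1 / 2"
      using assms(1) by (auto simp: rademacher_sequence_def)
    have sym: "symmetric_rv M (R i)" if "1 \<le> i" for i
      using ind p[OF that] that by (intro symmetric_rv_sign) (auto simp: indep_vars_def)
    define \<kappa> where "\<kappa> = \<phi> (real n) / \<psi> (real n)"
    have pos: "0 < \<phi> (real n)" "0 < \<psi> (real n)" using n S.\<phi>_pos S.\<psi>_pos by auto
    \<comment> \<open>The bound at index \<open>i\<close> is raised to the common bound at
      \<open>n\<close>, so a single factor \<kappa> serves all summands.\<close>
    have bound: "norm (x i) \<le> \<psi> (real n)" if "i \<in> {1..n}" for i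
      using x that S.\<psi>_le_iff[of "real i" "real n"] by (force intro: order_trans)
    \<comment> \<open>The variables here are the real signs; the vectors enter through the odd maps
      sending \<open>r\<close> to \<open>r\<close> times a fixed vector.\<close>
    have "\<P>(\<omega> in M. t * \<phi> (real n) < norm (\<Sum>i=1..n. R i \<omega> *\<^sub>R \<kappa> *\<^sub>R x i))
      \<le> 2 * \<P>(\<omega> in M. t * \<phi> (real n) < norm (\<Sum>i=1..n. R i \<omega> *\<^sub>R rescale \<phi> \<psi> (x i)))"
    proof (rule prob_contraction[where V=R and F="\<lambda>i r. r *\<^sub>R \<kappa> *\<^sub>R x i"
          and G="\<lambda>i r. r *\<^sub>R rescale \<phi> \<psi> (x i)"])
      show "indep_vars (\<lambda>_. borel) R {1..n}" using ind by (rule indep_vars_subset) auto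
      fix i :: nat and r :: real assume i: "i \<in> {1..n}"
      obtain c where "0 \<le> c" "c \<le> 1" "\<kappa> *\<^sub>R x i = c *\<^sub>R rescale \<phi> \<psi> (x i)"
        using S.scaled_eq_contracted_rescale[OF _ bound[OF i]] n by (auto simp: \<kappa>_def)
      then show "\<exists>c. 0 \<le> c \<and> c \<le> 1 \<and> r *\<^sub>R \<kappa> *\<^sub>R x i = c *\<^sub>R r *\<^sub>R rescale \<phi> \<psi> (x i)"
        by (metis scaleR_left_commute)
    qed (use n t pos sym in auto)
    moreover have "t * \<phi> (real n) < norm (\<Sum>i=1..n. R i \<omega> *\<^sub>R \<kappa> *\<^sub>R x i)
      \<longleftrightarrow> t * \<psi> (real n) < norm (\<Sum>i=1..n. R i \<omega> *\<^sub>R x i)" for \<omega>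
    proof -
      have "(\<Sum>i=1..n. R i \<omega> *\<^sub>R \<kappa> *\<^sub>R x i) = \<kappa> *\<^sub>R (\<Sum>i=1..n. R i \<omega> *\<^sub>R x i)"
        by (simp add: scaleR_sum_right mult.commute)
      then show ?thesis using pos by (simp add: \<kappa>_def field_simps)
    qed
    ultimately show "\<P>(\<omega> in M. norm (\<Sum>i=1..n. R i \<omega> *\<^sub>R x i) > t * \<psi> (real n))
          \<le> 2 * \<P>(\<omega> in M. norm (\<Sum>i=1..n. R i \<omega> *\<^sub>R rescale \<phi> \<psi> (x i)) > t * \<phi> (real n))"
      by simp
  next
    fix V :: "nat \<Rightarrow> 'c \<Rightarrow> 'b" and n :: nat and t :: real
    assume V: "prob_space.indep_vars N (\<lambda>_. borel) V {1..} \<and> (\<forall>n\<ge>1. symmetric_rv N (V n))"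
      and n: "1 \<le> n" and t: "0 \<le> t"
    interpret prob_space N by fact
    have rv[measurable]: "V i \<in> borel_measurable N" if "i \<in> {1..n}" for i
      using V that by (simp add: symmetric_rv_def)
    have [measurable]: "rescale \<phi> \<psi> \<in> borel_measurable (borel :: 'b measure)"
      by (rule S.rescale_measurable)
    define \<kappa> where "\<kappa> = \<phi> (real n) / \<psi> (real n)"
    have pos: "0 < \<phi> (real n)" "0 < \<psi> (real n)" using n S.\<phi>_pos S.\<psi>_pos by auto
    \<comment> \<open>Truncation at b_n enforces the norm bound behind the contraction; beyond it
      the coefficient 0 is used.\<close>
    define F where "F v = (if norm v \<le> \<psi> (real n) then \<kappa> *\<^sub>R v else 0)" for v :: 'b
    have F[measurable]: "F \<in> borel_measurable borel" unfolding F_def by measurable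
    have F_minus: "F (- v) = - F v" for v by (simp add: F_def)
    let ?E = "{\<omega> \<in> space N. t * \<phi> (real n) < norm (\<Sum>i=1..n. F (V i \<omega>))}"
    let ?T = "\<lambda>i. {\<omega> \<in> space N. norm (V i \<omega>) > \<psi> (real n)}"
    let ?Q = "\<P>(\<omega> in N. t * \<phi> (real n) < norm (\<Sum>i=1..n. rescale \<phi> \<psi> (V i \<omega>)))"
    have E: "?E \<in> events"
      using measurable_compose[OF rv F] by measurable
    have T: "?T i \<in> events" if "i \<in> {1..n}" for i
      using rv[OF that] by measurable
    have contr: "prob ?E \<le> 2 * ?Q"
    proof (rule prob_contraction[where V=V and F="\<lambda>_. F" and G="\<lambda>_. rescale \<phi> \<psi>"])
      show "indep_vars (\<lambda>_. borel) V {1..n}"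
        using conjunct1[OF V] by (rule indep_vars_subset) auto
      fix i :: nat and v :: 'b assume "i \<in> {1..n}"
      show "\<exists>c. 0 \<le> c \<and> c \<le> 1 \<and> F v = c *\<^sub>R rescale \<phi> \<psi> v"
      proof (cases "norm v \<le> \<psi> (real n)")
        case True
        then show ?thesis
          using S.scaled_eq_contracted_rescale[of "real n" v] n by (simp add: F_def \<kappa>_def)
      next
        case False
        then show ?thesis by (intro exI[of _ 0]) (simp add: F_def)
      qed
    qed (use n t pos V in \<open>auto simp: S.rescale_minus F_minus\<close>)
    \<comment> \<open>Outside the tail events \<open>?T i\<close> no summand is truncated, so the
      sum of the \<open>F (V i \<omega>)\<close> is exactly \<kappa> times the original sum.\<close>
    have "{\<omega> \<in> space N. norm (\<Sum>i=1..n. V i \<omega>) > t * \<psi> (real n)} \<subseteq> ?E \<union> (\<Union>i\<in>{1..n}. ?T i)"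
    proof
      fix \<omega> assume \<omega>: "\<omega> \<in> {\<omega> \<in> space N. norm (\<Sum>i=1..n. V i \<omega>) > t * \<psi> (real n)}"
      show "\<omega> \<in> ?E \<union> (\<Union>i\<in>{1..n}. ?T i)"
      proof (cases "\<exists>i\<in>{1..n}. norm (V i \<omega>) > \<psi> (real n)")
        case False
        then have "(\<Sum>i=1..n. F (V i \<omega>)) = \<kappa> *\<^sub>R (\<Sum>i=1..n. V i \<omega>)"
          unfolding scaleR_sum_right by (intro sum.cong refl) (auto simp: F_def not_less)
        then show ?thesis using \<omega> pos by (simp add: \<kappa>_def field_simps)
      qed (use \<omega> in auto)
    qed
    then have "\<P>(\<omega> in N. norm (\<Sum>i=1..n. V i \<omega>) > t * \<psi> (real n))
      \<le> prob (?E \<union> (\<Union>i\<in>{1..n}. ?T i))"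
      using E T by (intro finite_measure_mono) auto
    also have "\<dots> \<le> prob ?E + prob (\<Union>i\<in>{1..n}. ?T i)"
      using E T by (intro measure_Un_le) auto
    also have "\<dots> \<le> prob ?E + (\<Sum>i=1..n. prob (?T i))"
      using T by (intro add_left_mono finite_measure_subadditive_finite) auto
    \<comment> \<open>The contraction supplies 2 * \<open>?Q\<close>, which is at most 4 *
      \<open>?Q\<close> because a probability is nonnegative.\<close>
    also have "\<dots> \<le> 4 * ?Q + (\<Sum>i=1..n. prob (?T i))"
      using contr measure_nonneg[of N] by (smt (verit))
    finally show "\<P>(\<omega> in N. norm (\<Sum>i=1..n. V i \<omega>) > t * \<psi> (real n))
          \<le> 4 * \<P>(\<omega> in N. norm (\<Sum>i=1..n. rescale \<phi> \<psi> (V i \<omega>)) > t * \<phi> (real n))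
            + (\<Sum>i=1..n. \<P>(\<omega> in N. norm (V i \<omega>) > \<psi> (real n)))" .
  qed
qed

end
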